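(* Let $\mathit{AGT}$ be a set of agents that is an initial subset $\{0,1,\ldots\}$ of $\mathbb{N}$ (possibly $\mathbb{N}$ itself), and suppose $\mathit{Card}(\mathit{AGT})\ge 2$. Then a formula of $\mathcal{L}_{\mathsf{CSTIT}}^{\mathit{AGT}}$ is valid in BT+AC structures if and only if it is provable from S5($i$) (for every $i\in\mathit{AGT}$), Def($\Box$) and (GPerm$_k$) (for every $k\ge 0$) by the rules of modus ponens and $[i]$-necessitation (for every $i\in\mathit{AGT}$), where Def($\Box$) is the schema $\Box\varphi\leftrightarrow[1][0]\varphi$, and (GPerm$_k$) is the schema $\langle l\rangle\langle m\rangle\varphi\to\langle n\rangle\bigwedge_{i\le k,\ i\neq n}\langle i\rangle\varphi$, with $l,m,n$ ranging over $\mathit{AGT}$ and $k$ and $i$ over agents.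
   Context: Language. $\mathit{ATM}$ is a countably infinite set of atomic propositions and $\mathit{AGT}$ is a set of agents, an initial subset $\{0,1,\ldots\}$ of $\mathbb{N}$ (possibly $\mathbb{N}$). $\mathcal{L}_{\mathsf{CSTIT}}^{\mathit{AGT}}$ is given by $\varphi ::= p\mid\lnot\varphi\mid(\varphi\land\varphi)\mid[i]\varphi\mid\Box\varphi$ with $p\in\mathit{ATM}$, $i\in\mathit{AGT}$; other boolean connectives are abbreviations, $\Diamond\varphi$ abbreviates $\lnot\Box\lnot\varphi$ and $\langle i\rangle\varphi$ abbreviates $\lnot[i]\lnot\varphi$. An empty conjunction is $\top$. Semantics. A BT structure is $\langle W,<\rangle$ with $W$ a nonempty set of moments and $<$ a tree-like (strict partial) ordering: if $w_1<w_3$ and $w_2<w_3$ then $w_1=w_2$ or $w_1<w_2$ or $w_2<w_1$. A history is a maximal linearly ordered set of moments; $Hist$ is the set of histories and $H_w=\{h\in Hist: w\in h\}$. An index is a pair $w/h$ with $w\in W$, $h\in H_w$. A BT+AC model is $\mathcal{M}=\langle W,<,Choice,V\rangle$ where $\langle W,<\rangle$ is a BT structure, $V:\mathit{ATM}\to 2^{W\times Hist}$, and $Choice$ maps each agent $i$ and moment $w$ to a partition $Choice_i^w$ of $H_w$ such that $Choice_i^w\neq\emptyset$, every $Q\in Choice_i^w$ is nonempty, and for every $w$ and every map $s_w:\mathit{AGT}\to 2^{H_w}$ with $s_w(i)\in Choice_i^w$ for all $i$, $\bigcap_{i\in\mathit{AGT}}s_w(i)\neq\emptyset$. For $h\in H_w$,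 $Choice_i^w(h)$ is the member of $Choice_i^w$ containing $h$. Truth: $\mathcal{M},w/h\models p$ iff $w/h\in V(p)$; booleans as usual; $\mathcal{M},w/h\models\Box\varphi$ iff $\mathcal{M},w/h'\models\varphi$ for all $h'\in H_w$; $\mathcal{M},w/h\models[i]\varphi$ iff $\mathcal{M},w/h'\models\varphi$ for all $h'\in Choice_i^w(h)$. A formula is valid in BT+AC structures if it is true at every index of every BT+AC model. Axiomatics. S5($i$) denotes the usual axiom schemas of the normal modal logic S5 for $[i]$, over classical propositional logic. $[i]$-necessitation: from $\varphi$ infer $[i]\varphi$. *)

theory Defs
  imports "HOL-Library.Disjoint_Sets" "HOL-Library.Countable_Set"
begin

datatype 'p fm =
    Atm 'p
  | Neg "'p fm"
  | Conj "'p fm" "'p fm"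
  | Stit nat "'p fm"
  | Box "'p fm"

abbreviation Imp :: "'p fm \<Rightarrow> 'p fm \<Rightarrow> 'p fm" where
  "Imp \<phi> \<psi> \<equiv> Neg (Conj \<phi> (Neg \<psi>))"

abbreviation Iff :: "'p fm \<Rightarrow> 'p fm \<Rightarrow> 'p fm" where
  "Iff \<phi> \<psi> \<equiv> Conj (Imp \<phi> \<psi>) (Imp \<psi> \<phi>)"

abbreviation Stit_dual :: "nat \<Rightarrow> 'p fm \<Rightarrow> 'p fm" where
  "Stit_dual i \<phi> \<equiv> Neg (Stit i (Neg \<phi>))"

text \<open>The language has no primitive \<open>\<top>\<close>; any fixed atom serves to express it.\<close>

definition Top :: "'p fm" where
  "Top = Neg (Conj (Atm undefined) (Neg (Atm undefined)))"

fun BigConj :: "'p fm list \<Rightarrow> 'p fm" where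
  "BigConj [] = Top"
| "BigConj [\<phi>] = \<phi>"
| "BigConj (\<phi> # \<psi> # \<chi>s) = Conj \<phi> (BigConj (\<psi> # \<chi>s))"

inductive_set lang :: "nat set \<Rightarrow> 'p fm set" for AGT :: "nat set" where
  "Atm p \<in> lang AGT"
| "\<phi> \<in> lang AGT \<Longrightarrow> Neg \<phi> \<in> lang AGT"
| "\<phi> \<in> lang AGT \<Longrightarrow> \<psi> \<in> lang AGT \<Longrightarrow> Conj \<phi> \<psi> \<in> lang AGT"
| "i \<in> AGT \<Longrightarrow> \<phi> \<in> lang AGT \<Longrightarrow> Stit i \<phi> \<in> lang AGT"
| "\<phi> \<in> lang AGT \<Longrightarrow> Box \<phi> \<in> lang AGT"

definition initial_subset :: "nat set \<Rightarrow> bool" where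
  "initial_subset AGT \<longleftrightarrow> (\<forall>i\<in>AGT. \<forall>j\<le>i. j \<in> AGT)"

definition bt_structure :: "'w set \<Rightarrow> ('w \<Rightarrow> 'w \<Rightarrow> bool) \<Rightarrow> bool" where
  "bt_structure W R \<longleftrightarrow>
     W \<noteq> {} \<and> irreflp_on W R \<and> transp_on W R \<and>
     (\<forall>w1\<in>W. \<forall>w2\<in>W. \<forall>w3\<in>W. R w1 w3 \<and> R w2 w3 \<longrightarrow> w1 = w2 \<or> R w1 w2 \<or> R w2 w1)"

text \<open>The chains of \<^locale>\<open>pred_on\<close> are taken with respect to the reflexive closure of the
  given relation, so \<open>maxchain\<close> is the intended notion for the strict order \<open>R\<close>.\<close>

definition Hist :: "'w set \<Rightarrow> ('w \<Rightarrow> 'w \<Rightarrow> bool) \<Rightarrow> 'w set set" where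
  "Hist W R = {h. pred_on.maxchain W R h}"

definition Hist_at :: "'w set \<Rightarrow> ('w \<Rightarrow> 'w \<Rightarrow> bool) \<Rightarrow> 'w \<Rightarrow> 'w set set" where
  "Hist_at W R w = {h \<in> Hist W R. w \<in> h}"

record ('w, 'p) btac =
  moments :: "'w set"
  precedes :: "'w \<Rightarrow> 'w \<Rightarrow> bool"
  choices :: "nat \<Rightarrow> 'w \<Rightarrow> 'w set set set"
  val :: "'p \<Rightarrow> ('w \<times> 'w set) set"

abbreviation histories :: "('w, 'p) btac \<Rightarrow> 'w set set" where
  "histories M \<equiv> Hist (moments M) (precedes M)"

abbreviation histories_at :: "('w, 'p) btac \<Rightarrow> 'w \<Rightarrow> 'w set set" where
  "histories_at M w \<equiv> Hist_at (moments M) (precedes M) w"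

text \<open>Each member of a partition is nonempty by the definition of \<^const>\<open>partition_on\<close>.\<close>

definition btac_model :: "nat set \<Rightarrow> ('w, 'p) btac \<Rightarrow> bool" where
  "btac_model AGT M \<longleftrightarrow>
     bt_structure (moments M) (precedes M) \<and>
     (\<forall>i\<in>AGT. \<forall>w\<in>moments M.
        partition_on (histories_at M w) (choices M i w) \<and> choices M i w \<noteq> {}) \<and>
     (\<forall>w\<in>moments M. \<forall>s. (\<forall>i\<in>AGT. s i \<in> choices M i w) \<longrightarrow> (\<Inter>i\<in>AGT. s i) \<noteq> {}) \<and>
     (\<forall>p. val M p \<subseteq> moments M \<times> histories M)"

definition choice_at :: "('w, 'p) btac \<Rightarrow> nat \<Rightarrow> 'w \<Rightarrow> 'w set \<Rightarrow> 'w set set" where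
  "choice_at M i w h = (THE Q. Q \<in> choices M i w \<and> h \<in> Q)"

primrec sat :: "('w, 'p) btac \<Rightarrow> 'w \<Rightarrow> 'w set \<Rightarrow> 'p fm \<Rightarrow> bool" where
  "sat M w h (Atm p) \<longleftrightarrow> (w, h) \<in> val M p"
| "sat M w h (Neg \<phi>) \<longleftrightarrow> \<not> sat M w h \<phi>"
| "sat M w h (Conj \<phi> \<psi>) \<longleftrightarrow> sat M w h \<phi> \<and> sat M w h \<psi>"
| "sat M w h (Stit i \<phi>) \<longleftrightarrow> (\<forall>h'\<in>choice_at M i w h. sat M w h' \<phi>)"
| "sat M w h (Box \<phi>) \<longleftrightarrow> (\<forall>h'\<in>histories_at M w. sat M w h' \<phi>)"

text \<open>HOL cannot quantify over types inside a definition, so validity is relative to a type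
  \<open>'w\<close> from which the moments are drawn; the set of moments may be any nonempty
  subset of \<open>'w\<close>. Validity over one infinite type \<open>'w\<close> amounts to validity over all types, because
  refutable formulas have countable countermodels.\<close>

definition valid :: "'w itself \<Rightarrow> nat set \<Rightarrow> 'p fm \<Rightarrow> bool" where
  "valid (_ :: 'w itself) AGT \<phi> \<longleftrightarrow>
     (\<forall>M :: ('w, 'p) btac. btac_model AGT M \<longrightarrow>
        (\<forall>w\<in>moments M. \<forall>h\<in>histories_at M w. sat M w h \<phi>))"

text \<open>Tautologies are the substitution instances of classical ones: modal formulas are
  evaluated by \<open>v\<close> like atoms.\<close>

fun bool_eval :: "('p fm \<Rightarrow> bool) \<Rightarrow> 'p fm \<Rightarrow> bool" where
  "bool_eval v (Neg \<phi>) \<longleftrightarrow> \<not> bool_eval v \<phi>"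
| "bool_eval v (Conj \<phi> \<psi>) \<longleftrightarrow> bool_eval v \<phi> \<and> bool_eval v \<psi>"
| "bool_eval v \<phi> \<longleftrightarrow> v \<phi>"

definition tautology :: "'p fm \<Rightarrow> bool" where
  "tautology \<phi> \<longleftrightarrow> (\<forall>v. bool_eval v \<phi>)"

inductive provable :: "nat set \<Rightarrow> 'p fm \<Rightarrow> bool" for AGT :: "nat set" where
  Taut: "\<phi> \<in> lang AGT \<Longrightarrow> tautology \<phi> \<Longrightarrow> provable AGT \<phi>"
| S5_K: "i \<in> AGT \<Longrightarrow> \<phi> \<in> lang AGT \<Longrightarrow> \<psi> \<in> lang AGT \<Longrightarrow>
    provable AGT (Imp (Stit i (Imp \<phi> \<psi>)) (Imp (Stit i \<phi>) (Stit i \<psi>)))"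
| S5_T: "i \<in> AGT \<Longrightarrow> \<phi> \<in> lang AGT \<Longrightarrow> provable AGT (Imp (Stit i \<phi>) \<phi>)"
| S5_4: "i \<in> AGT \<Longrightarrow> \<phi> \<in> lang AGT \<Longrightarrow> provable AGT (Imp (Stit i \<phi>) (Stit i (Stit i \<phi>)))"
| S5_5: "i \<in> AGT \<Longrightarrow> \<phi> \<in> lang AGT \<Longrightarrow>
    provable AGT (Imp (Neg (Stit i \<phi>)) (Stit i (Neg (Stit i \<phi>))))"
| Def_Box: "\<phi> \<in> lang AGT \<Longrightarrow> provable AGT (Iff (Box \<phi>) (Stit 1 (Stit 0 \<phi>)))"
| GPerm: "k \<in> AGT \<Longrightarrow> l \<in> AGT \<Longrightarrow> m \<in> AGT \<Longrightarrow> n \<in> AGT \<Longrightarrow> \<phi> \<in> lang AGT \<Longrightarrow>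
    provable AGT (Imp (Stit_dual l (Stit_dual m \<phi>))
      (Stit_dual n (BigConj [Stit_dual i \<phi>. i \<leftarrow> [0..<Suc k], i \<noteq> n])))"
| MP: "provable AGT \<phi> \<Longrightarrow> provable AGT (Imp \<phi> \<psi>) \<Longrightarrow> provable AGT \<psi>"
| Nec: "i \<in> AGT \<Longrightarrow> provable AGT \<phi> \<Longrightarrow> provable AGT (Stit i \<phi>)"

end

theory Submission
  imports Defs
begin

text \<open>The canonical relation of agent \<open>i\<close> relates maximal consistent sets containing the same formulas
  \<open>[i]\<phi>\<close>. The schema (GPerm) makes the canonical frame satisfy: if \<open>v\<close> is reachable from \<open>u\<close> in two
  steps, then for every \<open>n\<close> some \<open>z\<close> is \<open>n\<close>-related to \<open>u\<close> and \<open>i\<close>-related to \<open>v\<close> for all other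
  \<open>i \<le> k\<close>. Hence \<open>R\<^sub>0\<close> and \<open>R\<^sub>1\<close> commute, any two points of a connected component are reachable from
  each other in two steps, and repairing one agent at a time shows that the choices of the agents
  \<open>0, \<dots>, k\<close> are independent. Both this property and the witnesses for \<open>[i]\<close> pass to a countable
  subset of the component, whose points become the histories through the root of a tree of depth one.\<close>

section \<open>Soundness\<close>

text \<open>Members of a partition are disjoint, so the definite description in
  \<open>choice_at\<close> denotes the one cell containing \<open>h\<close>, and all histories of
  that cell share it. Axioms T, 4 and 5 rest on this.\<close>

lemma choice_at_props:
  assumes "btac_model AGT M" "i \<in> AGT" "w \<in> moments M" "h \<in> histories_at M w"
  shows "choice_at M i w h \<in> choices M i w" "h \<in> choice_at M i w h"
    "choice_at M i w h \<subseteq> histories_at M w"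
    "\<And>h'. h' \<in> choice_at M i w h \<Longrightarrow> choice_at M i w h' = choice_at M i w h"
proof -
  have part: "partition_on (histories_at M w) (choices M i w)"
    using assms unfolding btac_model_def by blast
  have eq: "choice_at M i w g = Q" if "Q \<in> choices M i w" "g \<in> Q" for Q g
    unfolding choice_at_def
    by (rule the_equality) (use that part in \<open>auto simp: partition_on_def disjoint_def\<close>)
  obtain Q where Q: "Q \<in> choices M i w" "h \<in> Q"
    using assms(4) partition_onD1[OF part] by blast
  show "choice_at M i w h \<in> choices M i w" "h \<in> choice_at M i w h"
    "\<And>h'. h' \<in> choice_at M i w h \<Longrightarrow> choice_at M i w h' = choice_at M i w h"
    using eq Q by auto
  show "choice_at M i w h \<subseteq> histories_at M w"
    using eq[OF Q] Q partition_onD1[OF part] by blast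
qed

text \<open>Independence is applied to the selection that gives \<open>n\<close> the cell of
  \<open>h\<close> and every other agent the cell of \<open>h'\<close>.\<close>

lemma choice_at_independent:
  assumes M: "btac_model AGT M" "w \<in> moments M"
    and h: "h \<in> histories_at M w" "h' \<in> histories_at M w" and n: "n \<in> AGT"
  obtains g where "g \<in> histories_at M w" "g \<in> choice_at M n w h"
    "\<And>i. i \<in> AGT \<Longrightarrow> i \<noteq> n \<Longrightarrow> h' \<in> choice_at M i w g"
proof -
  let ?s = "\<lambda>i. choice_at M i w (if i = n then h else h')"
  have "\<forall>i\<in>AGT. ?s i \<in> choices M i w"
    using choice_at_props(1)[OF M(1) _ M(2)] h by simp
  then obtain g where g: "g \<in> (\<Inter>i\<in>AGT. ?s i)"
    using M unfolding btac_model_def by (metis (no_types, lifting) all_not_in_conv)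
  have 1: "g \<in> choice_at M n w h" using g n by auto
  have 2: "h' \<in> choice_at M i w g" if "i \<in> AGT" "i \<noteq> n" for i
  proof -
    have "g \<in> choice_at M i w h'" using g that by force
    then have "choice_at M i w g = choice_at M i w h'"
      by (rule choice_at_props(4)[OF M(1) that(1) M(2) h(2)])
    then show ?thesis
      using choice_at_props(2)[OF M(1) that(1) M(2) h(2)] by simp
  qed
  show ?thesis
    using that 1 2 choice_at_props(3)[OF M(1) n M(2) h(1)] by blast
qed

lemma sat_BigConj: "sat M w h (BigConj \<Phi>) \<longleftrightarrow> (\<forall>\<phi>\<in>set \<Phi>. sat M w h \<phi>)"
  by (induction \<Phi> rule: BigConj.induct) (auto simp: Top_def)

text \<open>Truth at an index is itself a boolean valuation of atoms and modal formulas, which makes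
  tautologies true there.\<close>

lemma sat_bool_eval: "bool_eval (sat M w h) \<phi> \<longleftrightarrow> sat M w h \<phi>"
  by (induction \<phi>) auto

lemma soundness:
  fixes M :: "('w, 'p) btac"
  assumes "provable AGT \<phi>" and AGT: "initial_subset AGT" "0 \<in> AGT" "1 \<in> AGT"
    and M: "btac_model AGT M" "w \<in> moments M" "h \<in> histories_at M w"
  shows "sat M w h \<phi>"
  using assms(1) M(3)
proof (induction arbitrary: h)
  case (Taut \<phi>)
  then show ?case using sat_bool_eval unfolding tautology_def by metis
next
  case (S5_K i \<phi> \<psi>)
  then show ?case by auto
next
  case (S5_T i \<phi>)
  then show ?case using choice_at_props(2)[OF M(1) _ M(2)] by auto
next
  case (S5_4 i \<phi>)
  then show ?case using choice_at_props(4)[OF M(1) _ M(2)] by auto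
next
  case (S5_5 i \<phi>)
  then show ?case using choice_at_props(4)[OF M(1) _ M(2)] by auto
next
  case (Def_Box \<phi>)
  \<comment> \<open>Independence with \<open>n = 1\<close> yields a history in the choice of agent 1
    at \<open>h\<close> from which agent 0 reaches \<open>h'\<close>; two steps thus cover all
    histories through \<open>w\<close>.\<close>
  have "sat M w h' \<phi>" if "sat M w h (Stit 1 (Stit 0 \<phi>))" "h' \<in> histories_at M w" for h'
    using choice_at_independent[OF M(1,2) Def_Box.prems that(2) AGT(3)] that(1) AGT(2)
    by (metis sat.simps(4) zero_neq_one)
  moreover have "sat M w g \<phi>"
    if "\<forall>g\<in>histories_at M w. sat M w g \<phi>" "f \<in> choice_at M 1 w h" "g \<in> choice_at M 0 w f" for f g
  proof -
    have "f \<in> histories_at M w"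
      using choice_at_props(3)[OF M(1) AGT(3) M(2) Def_Box.prems] that(2) by blast
    then have "choice_at M 0 w f \<subseteq> histories_at M w"
      by (rule choice_at_props(3)[OF M(1) AGT(2) M(2)])
    then show ?thesis using that by blast
  qed
  ultimately have "sat M w h (Box \<phi>) \<longleftrightarrow> sat M w h (Stit 1 (Stit 0 \<phi>))"
    unfolding sat.simps by blast
  then show ?case unfolding sat.simps(2,3) by blast
next
  case (GPerm k l m n \<phi>)
  have "\<exists>z\<in>choice_at M n w h. \<forall>i\<le>k. i \<noteq> n \<longrightarrow> (\<exists>g\<in>choice_at M i w z. sat M w g \<phi>)"
    if f: "f \<in> choice_at M l w h" and g: "g \<in> choice_at M m w f" and sat: "sat M w g \<phi>" for f g
  proof -
    have f': "f \<in> histories_at M w"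
      using f choice_at_props(3)[OF M(1) GPerm(2) M(2) GPerm.prems] by blast
    have g': "g \<in> histories_at M w"
      using g choice_at_props(3)[OF M(1) GPerm(3) M(2) f'] by blast
    \<comment> \<open>The intermediate \<open>f\<close> serves to show that \<open>g\<close> passes
      through \<open>w\<close>; independence links any two histories through
      \<open>w\<close>.\<close>
    obtain z where z: "z \<in> choice_at M n w h"
      "\<And>i. i \<in> AGT \<Longrightarrow> i \<noteq> n \<Longrightarrow> g \<in> choice_at M i w z"
      using choice_at_independent[OF M(1,2) GPerm.prems g' GPerm(4)] by metis
    have "i \<in> AGT" if "i \<le> k" for i
      using that GPerm(1) AGT(1) unfolding initial_subset_def by auto
    then show ?thesis using z sat by blast
  qed
  then show ?case by (fastforce simp: sat_BigConj less_Suc_eq_le simp del: upt_Suc)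
next
  case (MP \<phi> \<psi>)
  then show ?case by auto
next
  case (Nec i \<phi>)
  then show ?case using choice_at_props(3)[OF M(1) _ M(2)] by auto
qed

section \<open>Provability\<close>

lemma lang_simps [simp]:
  "Atm p \<in> lang A"
  "Neg \<phi> \<in> lang A \<longleftrightarrow> \<phi> \<in> lang A"
  "Conj \<phi> \<psi> \<in> lang A \<longleftrightarrow> \<phi> \<in> lang A \<and> \<psi> \<in> lang A"
  "Stit i \<phi> \<in> lang A \<longleftrightarrow> i \<in> A \<and> \<phi> \<in> lang A"
  "Box \<phi> \<in> lang A \<longleftrightarrow> \<phi> \<in> lang A"
  by (auto intro: lang.intros elim: lang.cases)

lemma BigConj_lang [simp]: "BigConj \<Phi> \<in> lang A \<longleftrightarrow> set \<Phi> \<subseteq> lang A"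
  by (induction \<Phi> rule: BigConj.induct) (auto simp: Top_def)

lemma bool_eval_BigConj [simp]:
  "bool_eval v (BigConj \<Phi>) \<longleftrightarrow> (\<forall>\<phi>\<in>set \<Phi>. bool_eval v \<phi>)"
  by (induction \<Phi> rule: BigConj.induct) (auto simp: Top_def)

lemma lang_mono: "\<phi> \<in> lang A \<Longrightarrow> A \<subseteq> B \<Longrightarrow> \<phi> \<in> lang B"
  by (induction rule: lang.induct) auto

text \<open>An instance of (GPerm) speaks of agents up to a bound, so the canonical construction
  runs over a finite initial segment containing the agents of the formula. The bound is at least 1
  because \<open>Box\<close> is axiomatised through agents 0 and 1.\<close>

lemma lang_bounded:
  assumes "initial_subset A" "0 \<in> A" "1 \<in> A" "\<phi> \<in> lang A"
  obtains k where "1 \<le> k" "{..k} \<subseteq> A" "\<phi> \<in> lang {..k}"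
proof -
  have down: "{..k} \<subseteq> A" if "k \<in> A" for k
    using assms(1) that unfolding initial_subset_def by auto
  have "\<exists>k\<in>A. 1 \<le> k \<and> \<phi> \<in> lang {..k}"
    using assms(4)
  proof (induction rule: lang.induct)
    case (3 \<phi> \<psi>)
    then obtain k l where "k \<in> A" "1 \<le> k" "\<phi> \<in> lang {..k}" "l \<in> A" "\<psi> \<in> lang {..l}" by blast
    moreover from this have "\<phi> \<in> lang {..max k l}" "\<psi> \<in> lang {..max k l}"
      by (auto elim!: lang_mono)
    ultimately show ?case by (intro bexI[of _ "max k l"]) (auto simp: max_def)
  next
    case (4 i \<phi>)
    then obtain k where "k \<in> A" "1 \<le> k" "\<phi> \<in> lang {..k}" by blast
    moreover from this have "\<phi> \<in> lang {..max i k}" by (auto elim!: lang_mono)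
    ultimately show ?case using 4 by (intro bexI[of _ "max i k"]) (auto simp: max_def)
  qed (use assms(3) in auto)
  then show thesis using that down by blast
qed

text \<open>Used in contraposed form: unprovability over \<open>AGT\<close> passes down to the
  finite segment that carries the countermodel.\<close>

lemma provable_mono: "provable A \<phi> \<Longrightarrow> A \<subseteq> B \<Longrightarrow> provable B \<phi>"
proof (induction rule: provable.induct)
  case (MP \<phi> \<psi>)
  then show ?case using provable.MP by blast
qed (blast intro: provable.intros lang_mono)+

text \<open>Relatedness is encoded as equality of cells, which makes the canonical relations
  equivalences by construction. The same function later plays the role of \<open>c\<close> in
  \<open>ksat\<close>.\<close>

definition cell :: "nat \<Rightarrow> 'p fm set \<Rightarrow> 'p fm set" where
  "cell i u = {\<phi>. Stit i \<phi> \<in> u}"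

context
  fixes A :: "nat set"
  assumes agents: "initial_subset A" "0 \<in> A" "1 \<in> A"
begin

lemma provable_lang: "provable A \<phi> \<Longrightarrow> \<phi> \<in> lang A"
proof (induction rule: provable.induct)
  case (GPerm k l m n \<phi>)
  then have "i \<in> A" if "i < Suc k" for i
    using agents(1) that unfolding initial_subset_def by auto
  then show ?case using GPerm by (auto simp del: upt_Suc)
qed (use agents in auto)

text \<open>Reduces propositional reasoning about theorems to a check on boolean valuations.
  Premises become antecedents one by one until a tautology remains, and modus ponens discharges
  them.\<close>

lemma provable_conseq:
  assumes "\<forall>\<psi>\<in>set \<Psi>. provable A \<psi>" "\<phi> \<in> lang A"
    and "\<And>v. \<forall>\<psi>\<in>set \<Psi>. bool_eval v \<psi> \<Longrightarrow> bool_eval v \<phi>"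
  shows "provable A \<phi>"
  using assms
proof (induction \<Psi> arbitrary: \<phi>)
  case Nil
  then show ?case by (auto intro: provable.Taut simp: tautology_def)
next
  case (Cons \<psi> \<Psi>)
  have \<psi>: "provable A \<psi>" using Cons.prems(1) by simp
  then have "\<psi> \<in> lang A" by (rule provable_lang)
  have "provable A (Imp \<psi> \<phi>)"
  proof (rule Cons.IH)
    show "\<forall>\<psi>\<in>set \<Psi>. provable A \<psi>" using Cons.prems(1) by simp
    show "Imp \<psi> \<phi> \<in> lang A" using \<open>\<psi> \<in> lang A\<close> Cons.prems(2) by simp
    show "bool_eval v (Imp \<psi> \<phi>)" if "\<forall>\<psi>\<in>set \<Psi>. bool_eval v \<psi>" for v
      using Cons.prems(3)[of v] that by auto
  qed
  with \<psi> show ?case by (rule provable.MP)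
qed

lemma provable_Imp_BigConj:
  assumes "\<And>\<psi>. \<psi> \<in> set \<Psi> \<Longrightarrow> provable A (Imp \<theta> \<psi>)" "\<theta> \<in> lang A"
  shows "provable A (Imp \<theta> (BigConj \<Psi>))"
proof (rule provable_conseq)
  show "\<forall>\<chi>\<in>set (map (Imp \<theta>) \<Psi>). provable A \<chi>"
    using assms(1) by auto
  show "Imp \<theta> (BigConj \<Psi>) \<in> lang A"
    using assms provable_lang by fastforce
qed auto

lemma provable_Stit_mono:
  assumes "provable A (Imp \<phi> \<psi>)" "i \<in> A"
  shows "provable A (Imp (Stit i \<phi>) (Stit i \<psi>))"
proof -
  have "\<phi> \<in> lang A" "\<psi> \<in> lang A" using provable_lang[OF assms(1)] by auto
  then show ?thesis
    using assms by (blast intro: provable.Nec provable.S5_K provable.MP)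
qed

lemma provable_Stit_dual_mono:
  assumes "provable A (Imp \<phi> \<psi>)" "i \<in> A"
  shows "provable A (Imp (Stit_dual i \<phi>) (Stit_dual i \<psi>))"
proof -
  have lang: "\<phi> \<in> lang A" "\<psi> \<in> lang A" using provable_lang[OF assms(1)] by auto
  have "provable A (Imp (Neg \<psi>) (Neg \<phi>))"
    by (rule provable_conseq[where \<Psi> = "[Imp \<phi> \<psi>]"]) (use assms lang in auto)
  then have "provable A (Imp (Stit i (Neg \<psi>)) (Stit i (Neg \<phi>)))"
    using assms(2) by (rule provable_Stit_mono)
  then show ?thesis
    by (intro provable_conseq[where \<Psi> = "[Imp (Stit i (Neg \<psi>)) (Stit i (Neg \<phi>))]"])
      (use assms lang in auto)
qed

section \<open>Maximal consistent sets\<close>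

definition consistent :: "'p fm set \<Rightarrow> bool" where
  "consistent u \<longleftrightarrow> (\<forall>\<Psi>. set \<Psi> \<subseteq> u \<longrightarrow> \<not> provable A (Neg (BigConj \<Psi>)))"

definition mcs :: "'p fm set \<Rightarrow> bool" where
  "mcs u \<longleftrightarrow> u \<subseteq> lang A \<and> consistent u \<and> (\<forall>\<phi>\<in>lang A. \<phi> \<in> u \<or> Neg \<phi> \<in> u)"

text \<open>Two refutations combine into one from \<open>u\<close> alone: a valuation makes
  \<open>\<phi>\<close> or its negation true, so the false conjunct of the corresponding list is a
  different formula and survives the filter.\<close>

lemma consistent_insert:
  assumes "consistent u" "u \<subseteq> lang A" "\<phi> \<in> lang A"
  shows "consistent (insert \<phi> u) \<or> consistent (insert (Neg \<phi>) u)"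
proof (rule ccontr)
  assume "\<not> ?thesis"
  then obtain \<Phi> \<Psi> where
    \<Phi>: "set \<Phi> \<subseteq> insert \<phi> u" "provable A (Neg (BigConj \<Phi>))" and
    \<Psi>: "set \<Psi> \<subseteq> insert (Neg \<phi>) u" "provable A (Neg (BigConj \<Psi>))"
    unfolding consistent_def by blast
  let ?\<Theta> = "filter (\<lambda>\<psi>. \<psi> \<noteq> \<phi>) \<Phi> @ filter (\<lambda>\<psi>. \<psi> \<noteq> Neg \<phi>) \<Psi>"
  have "set ?\<Theta> \<subseteq> u" using \<Phi>(1) \<Psi>(1) by auto
  moreover have "provable A (Neg (BigConj ?\<Theta>))"
  proof (rule provable_conseq[where \<Psi> = "[Neg (BigConj \<Phi>), Neg (BigConj \<Psi>)]"])
    show "Neg (BigConj ?\<Theta>) \<in> lang A"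
      using \<open>set ?\<Theta> \<subseteq> u\<close> assms(2) by (auto simp: subset_iff)
    fix v
    assume "\<forall>\<psi>\<in>set [Neg (BigConj \<Phi>), Neg (BigConj \<Psi>)]. bool_eval v \<psi>"
    then obtain \<alpha> \<beta> where "\<alpha> \<in> set \<Phi>" "\<not> bool_eval v \<alpha>" "\<beta> \<in> set \<Psi>" "\<not> bool_eval v \<beta>"
      by fastforce
    then show "bool_eval v (Neg (BigConj ?\<Theta>))"
      by (cases "bool_eval v \<phi>") fastforce+
  qed (use \<Phi> \<Psi> in auto)
  ultimately show False using assms(1) unfolding consistent_def by blast
qed

text \<open>Consistency has finite character, so unions of chains stay consistent and Zorn's lemma
  applies. A maximal set decides every formula by \<open>consistent_insert\<close>.\<close>

lemma Lindenbaum: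
  assumes "consistent \<Gamma>" "\<Gamma> \<subseteq> lang A"
  obtains u where "\<Gamma> \<subseteq> u" "mcs u"
proof -
  let ?\<A> = "{u. \<Gamma> \<subseteq> u \<and> u \<subseteq> lang A \<and> consistent u}"
  have "\<Union>\<C> \<in> ?\<A>" if chain: "\<C> \<noteq> {}" "subset.chain ?\<A> \<C>" for \<C>
  proof -
    have sub: "\<C> \<subseteq> ?\<A>" using chain(2) by (auto simp: subset_chain_def)
    have "consistent (\<Union>\<C>)"
      unfolding consistent_def
    proof (intro allI impI)
      fix \<Psi> assume "set \<Psi> \<subseteq> \<Union>\<C>"
      then obtain u where "u \<in> \<C>" "set \<Psi> \<subseteq> u"
        using finite_subset_Union_chain[of "set \<Psi>" \<C>] chain by (metis finite_set)
      then show "\<not> provable A (Neg (BigConj \<Psi>))"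
        using sub unfolding consistent_def by blast
    qed
    then show ?thesis using sub chain(1) by blast
  qed
  then obtain u where u: "u \<in> ?\<A>" and max: "\<forall>v\<in>?\<A>. u \<subseteq> v \<longrightarrow> v = u"
    using subset_Zorn_nonempty[of ?\<A>] assms by blast
  have "\<phi> \<in> u \<or> Neg \<phi> \<in> u" if "\<phi> \<in> lang A" for \<phi>
  proof -
    have *: "\<psi> \<in> u" if "consistent (insert \<psi> u)" "\<psi> \<in> lang A" for \<psi>
      using max[rule_format, of "insert \<psi> u"] that u by blast
    have "consistent (insert \<phi> u) \<or> consistent (insert (Neg \<phi>) u)"
      using consistent_insert u that by blast
    then show ?thesis using * that by auto
  qed
  then show thesis using that u unfolding mcs_def by blast
qed

text \<open>If \<open>\<phi>\<close> were missing, maximality would put its negation into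
  \<open>u\<close>, and together with \<open>\<Psi>\<close> this is a refutable finite list.\<close>

lemma mcs_conseq:
  assumes u: "mcs u" and "set \<Psi> \<subseteq> u" and th: "\<forall>\<theta>\<in>set \<Theta>. provable A \<theta>"
    and "\<phi> \<in> lang A"
    and conseq: "\<And>v. \<forall>\<psi>\<in>set \<Psi> \<union> set \<Theta>. bool_eval v \<psi> \<Longrightarrow> bool_eval v \<phi>"
  shows "\<phi> \<in> u"
proof (rule ccontr)
  assume "\<phi> \<notin> u"
  then have sub: "set (Neg \<phi> # \<Psi>) \<subseteq> u"
    using assms unfolding mcs_def by auto
  have "provable A (Neg (BigConj (Neg \<phi> # \<Psi>)))"
  proof (rule provable_conseq[OF th])
    show "Neg (BigConj (Neg \<phi> # \<Psi>)) \<in> lang A"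
      using sub u unfolding mcs_def by (simp only: lang_simps BigConj_lang) blast
  qed (use conseq in auto)
  then show False using sub u unfolding mcs_def consistent_def by blast
qed

lemma mcs_provable: "mcs u \<Longrightarrow> provable A \<phi> \<Longrightarrow> \<phi> \<in> u"
  by (rule mcs_conseq[of u "[]" "[\<phi>]"]) (auto intro: provable_lang)

lemma mcs_MP: "mcs u \<Longrightarrow> \<phi> \<in> u \<Longrightarrow> provable A (Imp \<phi> \<psi>) \<Longrightarrow> \<psi> \<in> u"
  by (rule mcs_conseq[of u "[\<phi>]" "[Imp \<phi> \<psi>]"]) (auto dest: provable_lang)

lemma mcs_lang: "mcs u \<Longrightarrow> \<phi> \<in> u \<Longrightarrow> \<phi> \<in> lang A"
  by (auto simp: mcs_def)

lemma mcs_Neg: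
  assumes "mcs u" "\<phi> \<in> lang A"
  shows "Neg \<phi> \<in> u \<longleftrightarrow> \<phi> \<notin> u"
proof -
  have False if "\<phi> \<in> u" "Neg \<phi> \<in> u"
  proof -
    have "Neg Top \<in> u"
      by (rule mcs_conseq[of u "[\<phi>, Neg \<phi>]" "[]"]) (use assms that in \<open>auto simp: Top_def\<close>)
    moreover have "provable A (Neg (BigConj [Neg Top]))"
      by (rule provable_conseq[of "[]"]) (auto simp: Top_def)
    ultimately show False
      using assms(1) unfolding mcs_def consistent_def
      by (metis empty_iff empty_set insert_iff list.simps(15) subsetI)
  qed
  then show ?thesis using assms unfolding mcs_def by blast
qed

lemma mcs_Conj:
  assumes "mcs u" "\<phi> \<in> lang A" "\<psi> \<in> lang A"
  shows "Conj \<phi> \<psi> \<in> u \<longleftrightarrow> \<phi> \<in> u \<and> \<psi> \<in> u"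
proof (intro iffI conjI)
  assume "\<phi> \<in> u \<and> \<psi> \<in> u"
  then show "Conj \<phi> \<psi> \<in> u"
    by (intro mcs_conseq[of u "[\<phi>, \<psi>]" "[]"]) (use assms in auto)
qed (rule mcs_conseq[of u "[Conj \<phi> \<psi>]" "[]"]; use assms in auto)+

lemma mcs_BigConj: "mcs u \<Longrightarrow> set \<Phi> \<subseteq> u \<Longrightarrow> BigConj \<Phi> \<in> u"
  by (rule mcs_conseq[of u \<Phi> "[]"]) (auto simp: mcs_lang subset_iff)

section \<open>Modal operators in maximal consistent sets\<close>

lemma mcs_Stit_refl: "mcs u \<Longrightarrow> Stit i \<phi> \<in> u \<Longrightarrow> \<phi> \<in> u"
  using mcs_MP provable.S5_T mcs_lang lang_simps(4) by metis

text \<open>Axioms 4 and 5 turn inclusion into equality.\<close>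

lemma cell_eqI:
  assumes "mcs u" "mcs v" "i \<in> A" "cell i u \<subseteq> v"
  shows "cell i u = cell i v"
proof -
  have "Stit i \<phi> \<in> v" if "Stit i \<phi> \<in> u" for \<phi>
  proof -
    have "Stit i (Stit i \<phi>) \<in> u"
      using mcs_MP[OF assms(1) that] provable.S5_4 mcs_lang[OF assms(1) that] by auto
    then show ?thesis using assms(4) unfolding cell_def by auto
  qed
  moreover have "Stit i \<phi> \<in> u" if "Stit i \<phi> \<in> v" for \<phi>
  proof (rule ccontr)
    assume "Stit i \<phi> \<notin> u"
    moreover have lang: "Stit i \<phi> \<in> lang A" using mcs_lang assms(2) that by blast
    ultimately have "Neg (Stit i \<phi>) \<in> u" using mcs_Neg assms(1) by blast
    then have "Stit i (Neg (Stit i \<phi>)) \<in> u"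
      using mcs_MP[OF assms(1)] provable.S5_5 lang unfolding lang_simps by blast
    then have "Neg (Stit i \<phi>) \<in> v" using assms(4) unfolding cell_def by auto
    then show False using mcs_Neg assms(2) lang that by blast
  qed
  ultimately show ?thesis unfolding cell_def by auto
qed

text \<open>This is normality of \<open>[i]\<close> for finitely many premises. The induction moves
  one premise at a time into the conclusion, where axiom K detaches it again.\<close>

lemma mcs_Stit_conseq:
  assumes "mcs u" "set \<Psi> \<subseteq> cell i u" "provable A (Imp (BigConj \<Psi>) \<chi>)" "i \<in> A"
  shows "Stit i \<chi> \<in> u"
  using assms(2,3)
proof (induction \<Psi> arbitrary: \<chi>)
  case Nil
  then have "provable A \<chi>"
    by (intro provable_conseq[of "[Imp (BigConj []) \<chi>]"])
      (auto simp: Top_def dest: provable_lang)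
  then show ?case using mcs_provable provable.Nec assms(1,4) by blast
next
  case (Cons \<psi> \<Psi>)
  have lang: "set (\<psi> # \<Psi>) \<subseteq> lang A" "\<chi> \<in> lang A"
    using provable_lang[OF Cons.prems(2)] by (auto simp del: set_simps)
  have "provable A (Imp (BigConj \<Psi>) (Imp \<psi> \<chi>))"
    by (rule provable_conseq[of "[Imp (BigConj (\<psi> # \<Psi>)) \<chi>]"]) (use Cons.prems lang in auto)
  then have 1: "Stit i (Imp \<psi> \<chi>) \<in> u" using Cons by auto
  have 2: "Stit i \<psi> \<in> u" using Cons.prems by (auto simp: cell_def)
  have "provable A (Imp (Stit i (Imp \<psi> \<chi>)) (Imp (Stit i \<psi>) (Stit i \<chi>)))"
    using provable.S5_K assms(4) lang by auto
  then have "Imp (Stit i \<psi>) (Stit i \<chi>) \<in> u" using mcs_MP assms(1) 1 by blast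
  then show ?case
    by (intro mcs_conseq[of u "[Stit i \<psi>, Imp (Stit i \<psi>) (Stit i \<chi>)]" "[]"])
      (use 2 assms lang in auto)
qed

text \<open>The common source of witnesses for \<open>[i]\<close> and of the points demanded by
  (GPerm). A refutation would split into a part \<open>?P\<close> from the cell and a part
  \<open>?Q\<close> from \<open>\<Delta>\<close>; the first puts \<open>[i]\<close> of the negated
  conjunction of \<open>?Q\<close> into \<open>u\<close>, against the possibility of
  \<open>?Q\<close>.\<close>

lemma mcs_successor:
  assumes u: "mcs u" and i: "i \<in> A" and \<Delta>: "\<Delta> \<subseteq> lang A"
    and poss: "\<And>\<Psi>. set \<Psi> \<subseteq> \<Delta> \<Longrightarrow> Stit_dual i (BigConj \<Psi>) \<in> u"
  obtains z where "mcs z" "cell i z = cell i u" "\<Delta> \<subseteq> z"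
proof -
  have lang: "cell i u \<union> \<Delta> \<subseteq> lang A"
    using \<Delta> by (auto simp: cell_def dest!: mcs_lang[OF u])
  have "consistent (cell i u \<union> \<Delta>)"
    unfolding consistent_def
  proof (intro allI impI notI)
    fix \<Psi> assume \<Psi>: "set \<Psi> \<subseteq> cell i u \<union> \<Delta>" "provable A (Neg (BigConj \<Psi>))"
    let ?P = "filter (\<lambda>\<psi>. \<psi> \<in> cell i u) \<Psi>" and ?Q = "filter (\<lambda>\<psi>. \<psi> \<notin> cell i u) \<Psi>"
    have PQ: "set ?P \<subseteq> cell i u" "set ?Q \<subseteq> \<Delta>" using \<Psi>(1) by auto
    have "provable A (Imp (BigConj ?P) (Neg (BigConj ?Q)))"
      by (rule provable_conseq[of "[Neg (BigConj \<Psi>)]"]) (use \<Psi> lang in auto)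
    then have "Stit i (Neg (BigConj ?Q)) \<in> u"
      using mcs_Stit_conseq u i PQ by blast
    then show False using mcs_Neg[OF u] mcs_lang[OF u] poss[OF PQ(2)] by blast
  qed
  then obtain z where "cell i u \<union> \<Delta> \<subseteq> z" "mcs z" using Lindenbaum lang by blast
  then show thesis using that cell_eqI[OF u _ i] by auto
qed

lemma mcs_Stit_witness:
  assumes "mcs u" "i \<in> A" "\<phi> \<in> lang A" "Stit i \<phi> \<notin> u"
  obtains z where "mcs z" "cell i z = cell i u" "\<phi> \<notin> z"
proof -
  \<comment> \<open>The list may be empty or repeat its only formula, so its conjunction is not
    literally \<open>Neg \<phi>\<close>; it is enough that the negated conjunction implies
    \<open>\<phi>\<close>.\<close>
  have "Stit_dual i (BigConj \<Psi>) \<in> u" if "set \<Psi> \<subseteq> {Neg \<phi>}" for \<Psi>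
  proof (rule ccontr)
    have lang: "set \<Psi> \<subseteq> lang A" using that assms(3) by auto
    assume "\<not> ?thesis"
    then have "Stit i (Neg (BigConj \<Psi>)) \<in> u"
      using mcs_Neg[OF assms(1), of "Stit i (Neg (BigConj \<Psi>))"] assms(2) lang by simp
    moreover have "provable A (Imp (Neg (BigConj \<Psi>)) \<phi>)"
      by (rule provable_conseq[of "[]"]) (use that assms lang in auto)
    ultimately show False
      using mcs_MP provable_Stit_mono assms by blast
  qed
  then obtain z where "mcs z" "cell i z = cell i u" "{Neg \<phi>} \<subseteq> z"
    using mcs_successor[OF assms(1,2), of "{Neg \<phi>}"] assms(3) by auto
  then show thesis using that mcs_Neg assms(3) by blast
qed

lemma mcs_Stit_dual:
  assumes "mcs u" "mcs v" "cell i u = cell i v" "i \<in> A" "\<phi> \<in> v"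
  shows "Stit_dual i \<phi> \<in> u"
proof (rule ccontr)
  have lang: "\<phi> \<in> lang A" using mcs_lang assms by blast
  assume "\<not> ?thesis"
  then have "Neg \<phi> \<in> cell i u"
    using mcs_Neg[OF assms(1), of "Stit i (Neg \<phi>)"] assms(4) lang by (simp add: cell_def)
  then have "Stit i (Neg \<phi>) \<in> v" unfolding assms(3) by (simp add: cell_def)
  then show False using mcs_Stit_refl mcs_Neg assms lang by blast
qed

text \<open>The semantic content of (GPerm). The desired \<open>z\<close> is an
  \<open>n\<close>-successor of \<open>u\<close> containing every \<open>Stit_dual i \<phi>\<close>
  with \<open>\<phi>\<close> in \<open>v\<close>; finite parts of this requirement are possible at
  \<open>u\<close> by a single axiom instance.\<close>

lemma mcs_permutation:
  assumes mcs: "mcs u" "mcs x" "mcs v" and lm: "cell l u = cell l x" "cell m x = cell m v"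
    and A: "l \<in> A" "m \<in> A" "n \<in> A" "k \<in> A" "{..k} \<subseteq> A"
  obtains z where "mcs z" "cell n z = cell n u"
    "\<And>i. i \<le> k \<Longrightarrow> i \<noteq> n \<Longrightarrow> cell i z = cell i v"
proof -
  let ?\<Delta> = "{Stit_dual i \<phi> | i \<phi>. i \<le> k \<and> i \<noteq> n \<and> \<phi> \<in> v}"
  have poss: "Stit_dual n (BigConj \<Psi>) \<in> u" if \<Psi>: "set \<Psi> \<subseteq> ?\<Delta>" for \<Psi>
  proof -
    have "\<forall>\<psi>\<in>set \<Psi>. \<exists>\<phi>. \<phi> \<in> v \<and> (\<exists>i. i \<le> k \<and> i \<noteq> n \<and> \<psi> = Stit_dual i \<phi>)"
      using \<Psi> by blast
    then obtain f where f: "\<And>\<psi>. \<psi> \<in> set \<Psi> \<Longrightarrow> f \<psi> \<in> v"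
      "\<And>\<psi>. \<psi> \<in> set \<Psi> \<Longrightarrow> \<exists>i. i \<le> k \<and> i \<noteq> n \<and> \<psi> = Stit_dual i (f \<psi>)" by metis
    \<comment> \<open>The listed formulas stem from different members of \<open>v\<close>, whereas
      (GPerm) speaks of one formula; their conjunction stands in for all of them, and monotonicity
      recovers each.\<close>
    let ?\<chi> = "BigConj (map f \<Psi>)"
    let ?\<theta> = "BigConj [Stit_dual i ?\<chi>. i \<leftarrow> [0..<Suc k], i \<noteq> n]"
    have \<chi>: "?\<chi> \<in> v" by (intro mcs_BigConj mcs(3)) (use f(1) in auto)
    then have \<chi>_lang: "?\<chi> \<in> lang A" using mcs_lang mcs(3) by blast
    have "Stit_dual l (Stit_dual m ?\<chi>) \<in> u"
      using mcs_Stit_dual mcs lm A(1,2) \<chi> by blast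
    then have \<theta>: "Stit_dual n ?\<theta> \<in> u"
      using mcs_MP[OF mcs(1)] provable.GPerm[OF A(4,1,2,3) \<chi>_lang] by blast
    have \<theta>_lang: "?\<theta> \<in> lang A" using mcs_lang[OF mcs(1) \<theta>] unfolding lang_simps by blast
    have "provable A (Imp ?\<theta> \<psi>)" if mem: "\<psi> \<in> set \<Psi>" for \<psi>
    proof -
      obtain i where i: "i \<le> k" "i \<noteq> n" "\<psi> = Stit_dual i (f \<psi>)" using f(2) mem by blast
      then have iA: "i \<in> A" using A(5) by auto
      have f_lang: "f \<psi> \<in> lang A" using f(1) mcs_lang mcs(3) mem by blast
      have \<psi>_lang: "\<psi> \<in> lang A" by (subst i(3)) (use iA f_lang in simp)
      have "provable A (Imp ?\<chi> (f \<psi>))"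
        by (rule provable_conseq[of "[]"]) (use \<chi>_lang f_lang mem in auto)
      then have *: "provable A (Imp (Stit_dual i ?\<chi>) \<psi>)"
        using provable_Stit_dual_mono iA i(3) by metis
      have mem': "Stit_dual i ?\<chi> \<in> set [Stit_dual i ?\<chi>. i \<leftarrow> [0..<Suc k], i \<noteq> n]"
        using i(1,2) by auto
      show ?thesis
      proof (rule provable_conseq[of "[Imp (Stit_dual i ?\<chi>) \<psi>]"])
        show "Imp ?\<theta> \<psi> \<in> lang A"
          unfolding lang_simps using \<theta>_lang \<psi>_lang by blast
        fix v
        assume "\<forall>\<alpha>\<in>set [Imp (Stit_dual i ?\<chi>) \<psi>]. bool_eval v \<alpha>"
        then have "bool_eval v (Imp (Stit_dual i ?\<chi>) \<psi>)" by simp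
        moreover have "bool_eval v ?\<theta> \<Longrightarrow> bool_eval v (Stit_dual i ?\<chi>)"
          using mem' unfolding bool_eval_BigConj by blast
        ultimately show "bool_eval v (Imp ?\<theta> \<psi>)"
          unfolding bool_eval.simps(1,2) by blast
      qed (use * in auto)
    qed
    then have "provable A (Imp ?\<theta> (BigConj \<Psi>))"
      using \<theta>_lang by (rule provable_Imp_BigConj)
    then show ?thesis using \<theta> mcs_MP[OF mcs(1)] provable_Stit_dual_mono A(3) by blast
  qed
  have "?\<Delta> \<subseteq> lang A" using A(5) mcs_lang[OF mcs(3)] by auto
  from mcs_successor[OF mcs(1) A(3) this poss]
  obtain z where z: "mcs z" "cell n z = cell n u" "?\<Delta> \<subseteq> z" by blast
  have "cell i z = cell i v" if i: "i \<le> k" "i \<noteq> n" for i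
  proof (rule cell_eqI[OF z(1) mcs(3)])
    show "i \<in> A" using i A(5) by auto
    show "cell i z \<subseteq> v"
    proof
      fix \<phi> assume "\<phi> \<in> cell i z"
      then have S: "Stit i \<phi> \<in> z" by (simp add: cell_def)
      then have lang: "\<phi> \<in> lang A" using mcs_lang[OF z(1) S] by simp
      show "\<phi> \<in> v"
      proof (rule ccontr)
        assume "\<phi> \<notin> v"
        then have "Neg \<phi> \<in> v" using mcs_Neg mcs(3) lang by blast
        then have dual: "Stit_dual i (Neg \<phi>) \<in> z" using z(3) i by blast
        \<comment> \<open>The dual of \<open>Neg \<phi>\<close> unfolds to a negated
          \<open>[i]\<close> of a double negation, so that double negation is introduced under
          \<open>[i]\<close> to reach the contradiction.\<close>
        have "provable A (Imp \<phi> (Neg (Neg \<phi>)))"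
          by (rule provable_conseq[of "[]"]) (use lang in auto)
        then have "Stit i (Neg (Neg \<phi>)) \<in> z"
          using mcs_MP provable_Stit_mono \<open>i \<in> A\<close> S z(1) by blast
        then show False using dual mcs_Neg mcs_lang z(1) by blast
      qed
    qed
  qed
  then show thesis using that z by blast
qed

lemma mcs_Box:
  assumes "mcs u" "\<phi> \<in> lang A"
  shows "Box \<phi> \<in> u \<longleftrightarrow> Stit 1 (Stit 0 \<phi>) \<in> u"
proof -
  have iff: "Iff (Box \<phi>) (Stit 1 (Stit 0 \<phi>)) \<in> u"
    using mcs_provable provable.Def_Box assms by blast
  show ?thesis
  proof
    assume "Box \<phi> \<in> u"
    then show "Stit 1 (Stit 0 \<phi>) \<in> u"
      by (intro mcs_conseq[of u "[Box \<phi>, Iff (Box \<phi>) (Stit 1 (Stit 0 \<phi>))]" "[]"])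
        (use iff assms agents in auto)
  next
    assume "Stit 1 (Stit 0 \<phi>) \<in> u"
    then show "Box \<phi> \<in> u"
      by (intro mcs_conseq[of u "[Stit 1 (Stit 0 \<phi>), Iff (Box \<phi>) (Stit 1 (Stit 0 \<phi>))]" "[]"])
        (use iff assms agents in auto)
  qed
qed

lemma not_provable_mcs:
  assumes "\<phi> \<in> lang A" "\<not> provable A \<phi>"
  obtains u where "mcs u" "\<phi> \<notin> u"
proof -
  have "consistent {Neg \<phi>}"
    unfolding consistent_def
  proof (intro allI impI notI)
    fix \<Psi> assume "set \<Psi> \<subseteq> {Neg \<phi>}" "provable A (Neg (BigConj \<Psi>))"
    then have "provable A \<phi>"
      by (intro provable_conseq[of "[Neg (BigConj \<Psi>)]"]) (use assms in auto)
    then show False using assms(2) by simp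
  qed
  then obtain u where "{Neg \<phi>} \<subseteq> u" "mcs u"
    using Lindenbaum[of "{Neg \<phi>}"] assms by auto
  then show thesis using that mcs_Neg assms by blast
qed

end

section \<open>A countable part of the canonical model\<close>

instance fm :: (countable) countable
  by countable_datatype

text \<open>The class instance requires a countable type of atoms, whereas here countability is a
  hypothesis; the atoms are therefore renamed to numbers first.\<close>

lemma countable_fm:
  assumes "countable (UNIV :: 'p set)"
  shows "countable (UNIV :: 'p fm set)"
proof -
  obtain f :: "'p \<Rightarrow> nat" where "inj f" using assms by (auto elim: countableE)
  then have "inj (to_nat \<circ> map_fm f)" by (intro inj_compose inj_to_nat fm.inj_map)
  then show ?thesis by (rule countableI)
qed

text \<open>A downward Loewenheim-Skolem argument: a Skolem function supplies the witnesses, and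
  closing under it in stages adds countably many points each time.\<close>

lemma countable_closure:
  assumes "countable I" "x \<in> C"
    and step: "\<And>j u v. j \<in> I \<Longrightarrow> u \<in> C \<Longrightarrow> v \<in> C \<Longrightarrow> \<exists>z\<in>C. P j u v z"
  obtains X where "X \<subseteq> C" "countable X" "x \<in> X"
    "\<forall>j\<in>I. \<forall>u\<in>X. \<forall>v\<in>X. \<exists>z\<in>X. P j u v z"
proof -
  obtain g where g: "\<And>j u v. j \<in> I \<Longrightarrow> u \<in> C \<Longrightarrow> v \<in> C \<Longrightarrow> g j u v \<in> C \<and> P j u v (g j u v)"
    using step by metis
  define F where "F = rec_nat {x} (\<lambda>_ Y. Y \<union> (\<lambda>(j, u, v). g j u v) ` (I \<times> Y \<times> Y))"
  have F0: "F 0 = {x}" and FS: "\<And>n. F (Suc n) = F n \<union> (\<lambda>(j, u, v). g j u v) ` (I \<times> F n \<times> F n)"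
    by (simp_all add: F_def)
  have F: "F n \<subseteq> C \<and> countable (F n)" for n
    by (induction n) (use assms(1,2) g in \<open>auto simp: F0 FS\<close>)
  have mono: "F m \<subseteq> F n" if "m \<le> n" for m n
    using that by (rule lift_Suc_mono_le[rotated]) (simp add: FS)
  show thesis
  proof (rule that[of "\<Union>n. F n"])
    show "x \<in> (\<Union>n. F n)" using F0 by blast
    have "\<exists>z\<in>(\<Union>n. F n). P j u v z"
      if j: "j \<in> I" and uv: "u \<in> (\<Union>n. F n)" "v \<in> (\<Union>n. F n)" for j u v
    proof -
      from uv obtain m n where "u \<in> F m" "v \<in> F n" by blast
      \<comment> \<open>Both points are already present at the later of their two stages, and the
        next stage contains their witness.\<close>
      then have uv: "u \<in> F (max m n)" "v \<in> F (max m n)"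
        using mono[of m "max m n"] mono[of n "max m n"] by auto
      then have "g j u v \<in> F (Suc (max m n))" using j by (force simp: FS)
      moreover have "P j u v (g j u v)" using g j uv F by blast
      ultimately show ?thesis by blast
    qed
    then show "\<forall>j\<in>I. \<forall>u\<in>(\<Union>n. F n). \<forall>v\<in>(\<Union>n. F n). \<exists>z\<in>(\<Union>n. F n). P j u v z"
      by blast
  qed (use F in auto)
qed

text \<open>In the following Kripke semantics, agent \<open>i\<close> cannot distinguish worlds with the same
  \<open>c i\<close>-value.\<close>

primrec ksat ::
  "'a set \<Rightarrow> (nat \<Rightarrow> 'a \<Rightarrow> 'b) \<Rightarrow> ('p \<Rightarrow> 'a set) \<Rightarrow> 'a \<Rightarrow> 'p fm \<Rightarrow> bool" where
  "ksat X c V x (Atm p) \<longleftrightarrow> x \<in> V p"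
| "ksat X c V x (Neg \<phi>) \<longleftrightarrow> \<not> ksat X c V x \<phi>"
| "ksat X c V x (Conj \<phi> \<psi>) \<longleftrightarrow> ksat X c V x \<phi> \<and> ksat X c V x \<psi>"
| "ksat X c V x (Stit i \<phi>) \<longleftrightarrow> (\<forall>y\<in>X. c i y = c i x \<longrightarrow> ksat X c V y \<phi>)"
| "ksat X c V x (Box \<phi>) \<longleftrightarrow> (\<forall>y\<in>X. ksat X c V y \<phi>)"

text \<open>A selection of one block per agent is encoded by representatives \<open>s i\<close> of
  the blocks.\<close>

definition independent :: "nat set \<Rightarrow> 'a set \<Rightarrow> (nat \<Rightarrow> 'a \<Rightarrow> 'b) \<Rightarrow> bool" where
  "independent A X c \<longleftrightarrow> (\<forall>s. (\<forall>i\<in>A. s i \<in> X) \<longrightarrow> (\<exists>z\<in>X. \<forall>i\<in>A. c i z = c i (s i)))"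

text \<open>The hypothesis overwrites the value of one agent and keeps those of the others up to
  \<open>k\<close>. Doing so for \<open>0, ..., k\<close> in turn reaches any prescribed
  combination; stage \<open>j\<close> has settled the agents below \<open>j\<close>.\<close>

lemma independent_if_permutation:
  assumes "X \<noteq> {}"
    and perm: "\<And>n u v. n \<le> k \<Longrightarrow> u \<in> X \<Longrightarrow> v \<in> X \<Longrightarrow>
      \<exists>z\<in>X. c n z = c n u \<and> (\<forall>i\<le>k. i \<noteq> n \<longrightarrow> c i z = c i v)"
  shows "independent {..k} X c"
  unfolding independent_def
proof (intro allI impI)
  fix s assume s: "\<forall>i\<in>{..k}. s i \<in> X"
  have "\<exists>z\<in>X. \<forall>i<j. c i z = c i (s i)" if "j \<le> Suc k" for j
    using that
  proof (induction j)
    case 0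
    then show ?case using assms(1) by auto
  next
    case (Suc j)
    then obtain v where v: "v \<in> X" "\<forall>i<j. c i v = c i (s i)" by auto
    have "j \<le> k" using Suc.prems by simp
    then obtain z where z: "z \<in> X" "c j z = c j (s j)" "\<forall>i\<le>k. i \<noteq> j \<longrightarrow> c i z = c i v"
      using perm[of j "s j" v] s v(1) by auto
    have "c i z = c i (s i)" if "i < Suc j" for i
      using that v(2) z(2,3) \<open>j \<le> k\<close> by (cases "i = j") auto
    then show ?case using z(1) by blast
  qed
  from this[of "Suc k"] show "\<exists>z\<in>X. \<forall>i\<in>{..k}. c i z = c i (s i)"
    by (auto simp: less_Suc_eq_le)
qed

lemma countable_Kripke_countermodel:
  fixes \<phi> :: "'p fm"
  assumes "countable (UNIV :: 'p set)" "1 \<le> k" "\<phi> \<in> lang {..k}" "\<not> provable {..k} \<phi>"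
  obtains X x and c :: "nat \<Rightarrow> 'p fm set \<Rightarrow> 'p fm set" and V
  where "countable X" "x \<in> X" "independent {..k} X c" "\<not> ksat X c V x \<phi>"
proof -
  let ?A = "{..k}"
  have A: "initial_subset ?A" "0 \<in> ?A" "1 \<in> ?A"
    using assms(2) by (auto simp: initial_subset_def)
  note [simp] = A
  let ?M = "mcs ?A"
  obtain r where r: "?M r" "\<phi> \<notin> r"
    using not_provable_mcs[OF A assms(3,4)] by blast
  have perm: "\<exists>z. ?M z \<and> cell n z = cell n u \<and> (\<forall>i\<le>k. i \<noteq> n \<longrightarrow> cell i z = cell i v)"
    if "?M u" "?M x" "?M v" "cell l u = cell l x" "cell m x = cell m v" "l \<le> k" "m \<le> k" "n \<le> k"
    for u x v l m n
    using mcs_permutation[OF A that(1-5), of n k] that(6-8) by (metis atMost_iff order_refl subset_refl)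
  \<comment> \<open>Two steps in this fixed order already exhaust the component of \<open>r\<close>,
    as the next two facts show.\<close>
  define C where "C = {v. ?M v \<and> (\<exists>x. ?M x \<and> cell 1 r = cell 1 x \<and> cell 0 x = cell 0 v)}"
  have rC: "r \<in> C" using r(1) by (auto simp: C_def)
  have C_step: "z \<in> C" if uz: "u \<in> C" "?M z" "cell i z = cell i u" "i \<le> k" for u z i
  proof -
    obtain x where x: "?M x" "cell 1 r = cell 1 x" "cell 0 x = cell 0 u" "?M u"
      using uz(1) unfolding C_def by blast
    \<comment> \<open>The path from \<open>x\<close> through \<open>u\<close> to \<open>z\<close>
      uses agents 0 and \<open>i\<close>; permutation replaces it by one using 1 and then 0, and the
      step of agent 1 merges with that from \<open>r\<close> to \<open>x\<close>.\<close>
    then obtain y where y: "?M y" "cell 1 y = cell 1 x" "cell 0 y = cell 0 z"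
      using perm[of x u z 0 i 1] uz assms(2) by (metis le0 zero_neq_one)
    then show ?thesis using x uz(2) by (auto simp: C_def)
  qed
  have C_conn: "\<exists>x. ?M x \<and> cell 1 u = cell 1 x \<and> cell 0 x = cell 0 v"
    if uv: "u \<in> C" "v \<in> C" for u v
  proof -
    obtain a b where a: "?M u" "?M a" "cell 1 r = cell 1 a" "cell 0 a = cell 0 u"
      and b: "?M v" "?M b" "cell 1 r = cell 1 b" "cell 0 b = cell 0 v"
      using uv unfolding C_def by blast
    \<comment> \<open>Both \<open>a\<close> and \<open>b\<close> are 1-related to \<open>r\<close>,
      so agents 0 and 1 lead from \<open>u\<close> to \<open>b\<close>. Swapping these steps lets
      the final one merge with that of agent 0 from \<open>b\<close> to \<open>v\<close>.\<close>
    obtain x where "?M x" "cell 1 x = cell 1 u" "cell 0 x = cell 0 b"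
      using perm[of u a b 0 1 1] a b assms(2) by (metis le0 zero_neq_one)
    then show ?thesis using b by metis
  qed
  \<comment> \<open>The requirements come in two kinds, so that one closure preserves both:
    \<open>Inl n\<close> asks for permutation at \<open>n\<close>, and
    \<open>Inr (i, \<psi>)\<close> for a point refuting \<open>\<psi>\<close> whenever
    \<open>[i]\<psi>\<close> fails.\<close>
  define P where "P j u v z \<longleftrightarrow> (case j of
      Inl n \<Rightarrow> cell n z = cell n u \<and> (\<forall>i\<le>k. i \<noteq> n \<longrightarrow> cell i z = cell i v)
    | Inr (i, \<psi>) \<Rightarrow> Stit i \<psi> \<in> u \<or> (cell i z = cell i u \<and> \<psi> \<notin> z))"
    for j :: "nat + nat \<times> 'p fm" and u v z
  have step: "\<exists>z\<in>C. P j u v z" if juv: "j \<in> ?A <+> (?A \<times> lang ?A)" "u \<in> C" "v \<in> C" for j u v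
  proof (cases j)
    case (Inl n)
    then have n: "n \<le> k" using juv(1) by auto
    obtain x where "?M x" "cell 1 u = cell 1 x" "cell 0 x = cell 0 v"
      using C_conn juv by blast
    then obtain z where "?M z" "cell n z = cell n u" "\<forall>i\<le>k. i \<noteq> n \<longrightarrow> cell i z = cell i v"
      using perm[of u x v 1 0 n] n juv(2,3) assms(2) by (auto simp: C_def)
    then show ?thesis using Inl C_step[OF juv(2) _ _ n] by (auto simp: P_def)
  next
    case (Inr q)
    then obtain i \<psi> where q: "j = Inr (i, \<psi>)" "i \<le> k" "\<psi> \<in> lang ?A"
      using juv(1) by auto
    show ?thesis
    proof (cases "Stit i \<psi> \<in> u")
      case True
      then show ?thesis using juv(2) q by (auto simp: P_def)
    next
      case False
      then obtain z where "?M z" "cell i z = cell i u" "\<psi> \<notin> z"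
        using mcs_Stit_witness[OF A, of u i \<psi>] q juv(2) by (auto simp: C_def)
      then show ?thesis using C_step[OF juv(2) _ _ q(2)] q(1) by (auto simp: P_def)
    qed
  qed
  have "countable (?A <+> (?A \<times> (lang ?A :: 'p fm set)))"
    using countable_subset[OF subset_UNIV countable_fm[OF assms(1)]] by (intro countable_Plus) auto
  then obtain X where X: "X \<subseteq> C" "countable X" "r \<in> X"
    and "\<forall>j\<in>?A <+> (?A \<times> lang ?A). \<forall>u\<in>X. \<forall>v\<in>X. \<exists>z\<in>X. P j u v z"
    by (rule countable_closure[where P = P, OF _ rC step])
  then have closed: "\<exists>z\<in>X. P j u v z"
    if "j \<in> ?A <+> (?A \<times> lang ?A)" "u \<in> X" "v \<in> X" for j u v
    using that by blast
  have X_mcs: "?M u" if "u \<in> X" for u using that X(1) by (auto simp: C_def)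
  have X_perm: "\<exists>z\<in>X. cell n z = cell n u \<and> (\<forall>i\<le>k. i \<noteq> n \<longrightarrow> cell i z = cell i v)"
    if "n \<le> k" "u \<in> X" "v \<in> X" for n u v
    using closed[of "Inl n" u v] that by (auto simp: P_def)
  have X_Stit: "Stit i \<psi> \<in> u \<longleftrightarrow> (\<forall>v\<in>X. cell i v = cell i u \<longrightarrow> \<psi> \<in> v)"
    if "u \<in> X" "i \<le> k" "\<psi> \<in> lang ?A" for u i \<psi>
  proof
    assume "Stit i \<psi> \<in> u"
    then have "\<psi> \<in> cell i u" by (simp add: cell_def)
    then have "Stit i \<psi> \<in> v" if eq: "cell i v = cell i u" for v
      unfolding eq[symmetric] by (simp add: cell_def)
    then show "\<forall>v\<in>X. cell i v = cell i u \<longrightarrow> \<psi> \<in> v"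
      using mcs_Stit_refl[OF A] X_mcs by blast
  next
    assume "\<forall>v\<in>X. cell i v = cell i u \<longrightarrow> \<psi> \<in> v"
    then show "Stit i \<psi> \<in> u"
      using closed[of "Inr (i, \<psi>)" u u] that by (auto simp: P_def)
  qed
  define V :: "'p \<Rightarrow> 'p fm set set" where "V p = {u. Atm p \<in> u}" for p
  have truth: "ksat X cell V u \<psi> \<longleftrightarrow> \<psi> \<in> u" if "\<psi> \<in> lang ?A" "u \<in> X" for u \<psi>
    using that
  proof (induction \<psi> arbitrary: u rule: fm.induct)
    case (Atm p)
    then show ?case by (simp add: V_def)
  next
    case (Neg \<psi>)
    then show ?case using mcs_Neg[OF A X_mcs, of u \<psi>] by simp
  next
    case (Conj \<psi> \<chi>)
    then show ?case using mcs_Conj[OF A X_mcs, of u \<psi> \<chi>] by simp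
  next
    case (Stit i \<psi>)
    then show ?case using X_Stit by simp
  next
    case (Box \<psi>)
    then have \<psi>: "\<psi> \<in> lang ?A" by simp
    have "Box \<psi> \<in> u \<longleftrightarrow> Stit 1 (Stit 0 \<psi>) \<in> u"
      using mcs_Box[OF A] X_mcs \<psi> Box.prems(2) by blast
    also have "\<dots> \<longleftrightarrow> (\<forall>x\<in>X. cell 1 x = cell 1 u \<longrightarrow> (\<forall>v\<in>X. cell 0 v = cell 0 x \<longrightarrow> \<psi> \<in> v))"
      using X_Stit \<psi> Box.prems(2) assms(2) by simp
    \<comment> \<open>For every \<open>v\<close> in \<open>X\<close>, permutation at agent 1
      supplies a midpoint 1-related to \<open>u\<close> and 0-related to \<open>v\<close>, so the
      two quantifiers range over all of \<open>X\<close>.\<close>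
    also have "\<dots> \<longleftrightarrow> (\<forall>v\<in>X. \<psi> \<in> v)"
      using X_perm[of 1 u] Box.prems(2) assms(2) by (metis le0 zero_neq_one)
    finally show ?case using Box.IH \<psi> by simp
  qed
  show thesis
  proof (rule that)
    show "independent ?A X cell"
      using independent_if_permutation[of X k cell] X_perm X(3) by blast
    show "\<not> ksat X cell V r \<phi>" using truth assms(3) X(3) r(2) by blast
  qed (use X in auto)
qed

section \<open>From Kripke models to branching time\<close>

lemma btac_model_of_Kripke:
  fixes c :: "nat \<Rightarrow> 'a \<Rightarrow> 'b" and V :: "'p \<Rightarrow> 'a set"
  assumes X: "countable X" "X \<noteq> {}" and inf: "infinite (UNIV :: 'w set)"
    and indep: "independent A X c" and A: "A \<noteq> {}"
  obtains M :: "('w, 'p) btac" and w hist where "btac_model A M" "w \<in> moments M"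
    "\<And>x. x \<in> X \<Longrightarrow> hist x \<in> histories_at M w"
    "\<And>x \<phi>. x \<in> X \<Longrightarrow> \<phi> \<in> lang A \<Longrightarrow> sat M w (hist x) \<phi> \<longleftrightarrow> ksat X c V x \<phi>"
proof -
  obtain e :: "nat \<Rightarrow> 'w" where e: "inj e" using infinite_countable_subset[OF inf] by blast
  define root where "root = e 0"
  \<comment> \<open>The value \<open>e 0\<close> is taken by the root, so leaves are numbered from
    1.\<close>
  define leaf where "leaf x = e (Suc (to_nat_on X x))" for x
  have leaf_inj: "leaf x = leaf y \<longleftrightarrow> x = y" if "x \<in> X" "y \<in> X" for x y
    using that e inj_on_to_nat_on[OF X(1)] unfolding leaf_def by (auto simp: inj_eq inj_on_eq_iff)
  have leaf_root: "leaf x \<noteq> root" for x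
    using e by (simp add: leaf_def root_def inj_eq)
  define hist where "hist x = {root, leaf x}" for x
  have hist_inj: "hist x = hist y \<longleftrightarrow> x = y" if "x \<in> X" "y \<in> X" for x y
    using leaf_inj[OF that] leaf_root unfolding hist_def by (metis doubleton_eq_iff)
  define W where "W = insert root (leaf ` X)"
  have root: "root \<in> W" by (simp add: W_def)
  define R where "R a b \<longleftrightarrow> a = root \<and> b \<in> leaf ` X" for a b
  have chain: "pred_on.chain W R (hist x)" if "x \<in> X" for x
    using that unfolding pred_on.chain_def hist_def W_def R_def by auto
  \<comment> \<open>Distinct leaves are incomparable, so a chain contains at most one; a chain
    without a leaf fits into any history.\<close>
  have sub_hist: "\<exists>x\<in>X. C \<subseteq> hist x" if C: "pred_on.chain W R C" for C
  proof (cases "C \<subseteq> {root}")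
    case True
    then show ?thesis using X(2) unfolding hist_def by blast
  next
    case False
    then obtain x where x: "x \<in> X" "leaf x \<in> C"
      using C unfolding pred_on.chain_def W_def by blast
    have "y = root \<or> y = leaf x" if "y \<in> C" for y
      using C that x(2) leaf_root unfolding pred_on.chain_def R_def by auto
    then show ?thesis using x(1) unfolding hist_def by blast
  qed
  have Hist: "Hist W R = hist ` X"
  proof (intro equalityI subsetI)
    fix h assume "h \<in> Hist W R"
    then have h: "pred_on.maxchain W R h" by (simp add: Hist_def)
    then obtain x where "x \<in> X" "h \<subseteq> hist x"
      using sub_hist unfolding pred_on.maxchain_def by blast
    moreover have "\<not> h \<subset> hist x" using h chain[OF \<open>x \<in> X\<close>] unfolding pred_on.maxchain_def by blast
    ultimately show "h \<in> hist ` X" by blast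
  next
    fix h assume "h \<in> hist ` X"
    then obtain x where x: "x \<in> X" "h = hist x" by blast
    have False if C: "pred_on.chain W R C" "hist x \<subset> C" for C
    proof -
      obtain y where y: "y \<in> X" "C \<subseteq> hist y" using sub_hist C(1) by blast
      then have "leaf x \<in> hist y" using C(2) unfolding hist_def by blast
      then have "x = y" using leaf_inj x(1) y(1) leaf_root unfolding hist_def by auto
      then show False using C(2) y(2) by blast
    qed
    then show "h \<in> Hist W R" using chain x unfolding Hist_def pred_on.maxchain_def by blast
  qed
  have at_root: "Hist_at W R root = hist ` X"
    unfolding Hist_at_def Hist by (auto simp: hist_def)
  have at_leaf: "Hist_at W R (leaf x) = {hist x}" if "x \<in> X" for x
    unfolding Hist_at_def Hist using that leaf_inj leaf_root by (auto simp: hist_def)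
  define block where "block i x = hist ` {y \<in> X. c i y = c i x}" for i x
  \<comment> \<open>Only one history passes through a leaf, which leaves a single block
    there.\<close>
  define Ch where "Ch i w = (if w = root then block i ` X else {Hist_at W R w})" for i w
  \<comment> \<open>The operators never leave a moment, so only valuations at the root matter.
    Intersecting with \<open>X\<close> keeps to points that yield histories and on which
    \<open>hist\<close> is injective.\<close>
  define M :: "('w, 'p) btac" where
    "M = \<lparr>moments = W, precedes = R, choices = Ch, val = \<lambda>p. {root} \<times> hist ` (V p \<inter> X)\<rparr>"
  have sel [simp]: "moments M = W" "precedes M = R" "choices M = Ch"
    "val M = (\<lambda>p. {root} \<times> hist ` (V p \<inter> X))"
    by (simp_all add: M_def)
  have mem_block: "hist y \<in> block i x \<longleftrightarrow> c i y = c i x" if "x \<in> X" "y \<in> X" for i x y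
    using that hist_inj unfolding block_def by auto
  have part_root: "partition_on (hist ` X) (block i ` X)" for i
  proof (rule partition_onI)
    show "\<Union> (block i ` X) = hist ` X" unfolding block_def by blast
    show "disjnt p q" if pq: "p \<in> block i ` X" "q \<in> block i ` X" "p \<noteq> q" for p q
    proof -
      obtain x y where xy: "x \<in> X" "y \<in> X" "p = block i x" "q = block i y" using pq by blast
      have ne: "c i x \<noteq> c i y" using pq(3) xy unfolding block_def by auto
      have "h \<notin> q" if "h \<in> p" for h
      proof -
        obtain z where z: "z \<in> X" "h = hist z" "c i z = c i x"
          using \<open>h \<in> p\<close> xy(3) unfolding block_def by blast
        then show ?thesis using mem_block[OF xy(2) z(1)] ne xy(4) by simp
      qed
      then show ?thesis unfolding disjnt_def by blast
    qed
    show "{} \<notin> block i ` X" unfolding block_def by blast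
  qed
  have indep_root: "(\<Inter>i\<in>A. s i) \<noteq> {}" if s: "\<forall>i\<in>A. s i \<in> block i ` X" for s
  proof -
    have "\<forall>i\<in>A. \<exists>x. x \<in> X \<and> s i = block i x" using s by blast
    from bchoice[OF this] obtain t where t: "\<forall>i\<in>A. t i \<in> X \<and> s i = block i (t i)" ..
    then obtain z where "z \<in> X" "\<forall>i\<in>A. c i z = c i (t i)"
      using indep unfolding independent_def by blast
    then have "hist z \<in> (\<Inter>i\<in>A. s i)" using t mem_block by auto
    then show ?thesis by blast
  qed
  have model: "btac_model A M"
    unfolding btac_model_def
  proof (intro conjI ballI allI impI)
    show "bt_structure (moments M) (precedes M)"
      using leaf_root unfolding bt_structure_def sel W_def R_def
      by (auto simp: irreflp_on_def transp_on_def)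
    fix i w assume "w \<in> moments M"
    then consider "w = root" | x where "x \<in> X" "w = leaf x" by (auto simp: W_def)
    then show "partition_on (histories_at M w) (choices M i w)"
    proof cases
      case 1
      then show ?thesis using part_root by (simp add: at_root Ch_def)
    next
      case 2
      then show ?thesis using leaf_root by (simp add: at_leaf Ch_def partition_on_space)
    qed
    show "choices M i w \<noteq> {}" using X(2) by (simp add: Ch_def)
  next
    fix w s assume "w \<in> moments M" and s: "\<forall>i\<in>A. s i \<in> choices M i w"
    then consider "w = root" | x where "x \<in> X" "w = leaf x" by (auto simp: W_def)
    then show "(\<Inter>i\<in>A. s i) \<noteq> {}"
    proof cases
      case 1
      then show ?thesis using s indep_root by (simp add: Ch_def)
    next
      case 2
      then have "hist x \<in> (\<Inter>i\<in>A. s i)" using s leaf_root by (auto simp: at_leaf Ch_def)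
      then show ?thesis by blast
    qed
  next
    fix p show "val M p \<subseteq> moments M \<times> histories M"
      unfolding sel Hist using root by auto
  qed
  have choice: "choice_at M i root (hist x) = block i x" if x: "x \<in> X" for i x
    unfolding choice_at_def
  proof (rule the_equality)
    show "block i x \<in> choices M i root \<and> hist x \<in> block i x"
      using x mem_block by (simp add: Ch_def)
    fix Q assume "Q \<in> choices M i root \<and> hist x \<in> Q"
    then obtain y where "y \<in> X" "Q = block i y" "c i x = c i y"
      using x mem_block by (auto simp: Ch_def)
    then show "Q = block i x" by (simp add: block_def)
  qed
  show thesis
  proof (rule that[OF model])
    show "root \<in> moments M" using root by simp
    show "hist x \<in> histories_at M root" if "x \<in> X" for x using that by (simp add: at_root)
    show "sat M root (hist x) \<phi> \<longleftrightarrow> ksat X c V x \<phi>" if "x \<in> X" "\<phi> \<in> lang A" for x \<phi>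
      using that
    proof (induction \<phi> arbitrary: x rule: fm.induct)
      case (Atm p)
      then show ?case using hist_inj by auto
    next
      case (Stit i \<phi>)
      then show ?case by (auto simp: choice block_def)
    qed (auto simp: at_root)
  qed
qed

text \<open>Only finitely many agents occur in a formula; all the others receive the trivial choice.\<close>

lemma completeness:
  fixes \<phi> :: "'p fm"
  assumes "countable (UNIV :: 'p set)" "infinite (UNIV :: 'w set)"
    and AGT: "initial_subset AGT" "0 \<in> AGT" "1 \<in> AGT"
    and "\<phi> \<in> lang AGT" "valid TYPE('w) AGT \<phi>"
  shows "provable AGT \<phi>"
proof (rule ccontr)
  assume not: "\<not> provable AGT \<phi>"
  obtain k where k: "1 \<le> k" "{..k} \<subseteq> AGT" "\<phi> \<in> lang {..k}"
    using lang_bounded[OF AGT assms(6)] by blast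
  have "\<not> provable {..k} \<phi>" using not provable_mono k(2) by blast
  then obtain X x V and c :: "nat \<Rightarrow> 'p fm set \<Rightarrow> 'p fm set"
    where K: "countable X" "x \<in> X" "independent {..k} X c" "\<not> ksat X c V x \<phi>"
    using countable_Kripke_countermodel[OF assms(1) k(1,3)] by metis
  define d where "d i u = (if i \<le> k then c i u else {})" for i u
  have "independent AGT X d"
    unfolding independent_def
  proof (intro allI impI)
    fix s assume "\<forall>i\<in>AGT. s i \<in> X"
    then obtain z where "z \<in> X" "\<forall>i\<in>{..k}. c i z = c i (s i)"
      using K(3) k(2) unfolding independent_def by (metis subsetD)
    then show "\<exists>z\<in>X. \<forall>i\<in>AGT. d i z = d i (s i)" by (auto simp: d_def)
  qed
  moreover have "X \<noteq> {}" "AGT \<noteq> {}" using K(2) AGT(2) by auto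
  ultimately obtain M :: "('w, 'p) btac" and w hist where M: "btac_model AGT M" "w \<in> moments M"
    "hist x \<in> histories_at M w" "sat M w (hist x) \<phi> \<longleftrightarrow> ksat X d V x \<phi>"
    using btac_model_of_Kripke[OF K(1) _ assms(2), of AGT d] K(2) assms(6) by metis
  \<comment> \<open>Agents beyond \<open>k\<close> do not occur in these formulas, so passing from
    \<open>c\<close> to \<open>d\<close> leaves their truth unchanged.\<close>
  have "ksat X d V y \<psi> \<longleftrightarrow> ksat X c V y \<psi>" if "\<psi> \<in> lang {..k}" for y \<psi>
    using that by (induction \<psi> arbitrary: y rule: fm.induct) (auto simp: d_def)
  then show False using M K(4) k(3) assms(7) unfolding valid_def by blast
qed

theorem theorem3:
  fixes AGT :: "nat set" and \<phi> :: "'p fm"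
  assumes "countable (UNIV :: 'p set)" and "infinite (UNIV :: 'p set)"
    and "infinite (UNIV :: 'w set)"
    and "initial_subset AGT"
    and "infinite AGT \<or> card AGT \<ge> 2"
    and "\<phi> \<in> lang AGT"
  shows "valid TYPE('w) AGT \<phi> \<longleftrightarrow> provable AGT \<phi>"
proof -
  \<comment> \<open>Two agents force one different from 0, and downward closure then supplies both 0
    and 1.\<close>
  have "\<not> AGT \<subseteq> {0}"
    using assms(5) finite_subset[of AGT "{0}"] card_mono[of "{0}" AGT] by auto
  then obtain i where i: "i \<in> AGT" "i \<noteq> 0" by blast
  then have agents: "0 \<in> AGT" "1 \<in> AGT"
    using assms(4) unfolding initial_subset_def
    by (metis le0, metis One_nat_def Suc_leI bot_nat_0.not_eq_extremum)
  show ?thesis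
  proof
    assume "valid TYPE('w) AGT \<phi>"
    then show "provable AGT \<phi>" by (rule completeness[OF assms(1,3,4) agents assms(6)])
  next
    assume "provable AGT \<phi>"
    then show "valid TYPE('w) AGT \<phi>"
      unfolding valid_def by (intro allI impI ballI soundness[OF _ assms(4) agents])
  qed
qed

end
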